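(* Let $p\ge2$, let $(l,r)$ be a $p$-admissible constraint pair, and let $S,\tilde{S}\in S_G^p(0,T)$ with $S_0=\tilde{S}_0$. Given $c_0,\tilde{c}_0\in\mathbb{R}$, let $(X,A)$ and $(\tilde{X},\tilde{A})$ be the solutions to the reflected problem with constraints $l,r$ for $c_0+S$ and $\tilde{c}_0+\tilde{S}$, respectively, and let $(A^l,A^r)$, $(\tilde{A}^l,\tilde{A}^r)$ be the corresponding constraining processes. If there exists a nondecreasing process $\nu\in S_G^p(0,T)$ with $\nu_0=0$ such that $S=\tilde{S}+\nu$, then for each $t\in [0,T]$: 1. $A^r_t-(c_0-\tilde{c}_0)^-\leq \tilde{A}^r_t\leq A^r_t+\nu_t+(c_0-\tilde{c}_0)^+$, q.s.; 2. $\tilde{A}^l_t-(c_0-\tilde{c}_0)^-\leq A^l_t\leq \tilde{A}^l_t+\nu_t+(c_0-\tilde{c}_0)^+$, q.s.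
   Context: $a^+=\max(a,0)$, $a^-=\max(-a,0)$. Fix $T>0$. $\Omega_T=C_0([0,T];\mathbb{R})$ is the space of real continuous functions on $[0,T]$ vanishing at $0$, with the supremum norm; $B$ is the canonical process. Fix $0\le\underline{\sigma}^2<\bar{\sigma}^2$ and set $G(a)=\frac12(\bar{\sigma}^2a^+-\underline{\sigma}^2a^-)$. $C_{l,Lip}(\mathbb{R}^n)$ is the set of functions $\varphi$ with $|\varphi(x)-\varphi(y)|\le C(1+|x|^k+|y|^k)|x-y|$ for some $C,k$; $C_{b,Lip}(\mathbb{R}^n)$ is the set of bounded Lipschitz functions. $L_{ip}(\Omega_t)=\{\varphi(B_{t_1},\dots,B_{t_n}): n\in\mathbb{N},\ t_1,\dots,t_n\in[0,t],\ \varphi\in C_{l,Lip}(\mathbb{R}^n)\}$. $\hat{\mathbb{E}}:L_{ip}(\Omega_T)\to\mathbb{R}$ is the $G$-expectation, i.e. the sublinear expectation under which $B$ is a $G$-Brownian motion: for $0\le s\le t\le T$ and $\varphi\in C_{l,Lip}(\mathbb{R})$, $\hat{\mathbb{E}}[\varphi(x+B_t-B_s)]=u(t-s,x)$ where $u$ is the viscosity solution of $\partial_tu-G(\partial_x^2u)=0$, $u(0,\cdot)=\varphi$, and for $0\le t_1\le\dots\le t_n\le T$, $\varphi\in C_{l,Lip}(\mathbb{R}^n)$, $\hat{\mathbb{E}}[\varphi(B_{t_1},\dots,B_{t_{n-1}},B_{t_n}-B_{t_{n-1}})]=\hat{\mathbb{E}}[\psi(B_{t_1},\dots,B_{t_{n-1}})]$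 with $\psi(x_1,\dots,x_{n-1})=\hat{\mathbb{E}}[\varphi(x_1,\dots,x_{n-1},B_{t_n}-B_{t_{n-1}})]$. For $p\ge1$, $L_G^p(\Omega_T)$ is the completion of $L_{ip}(\Omega_T)$ under $(\hat{\mathbb{E}}[|\xi|^p])^{1/p}$, to which $\hat{\mathbb E}$ extends. There is a weakly compact set $\mathcal{P}$ of probability measures on $(\Omega_T,\mathcal{B}(\Omega_T))$ (fixed) with $\hat{\mathbb{E}}[\xi]=\sup_{P\in\mathcal{P}}E_P[\xi]$ for $\xi\in L_G^1(\Omega_T)$. A Borel set $A$ is polar if $\sup_{P\in\mathcal{P}}P(A)=0$; a property holds quasi-surely (q.s.) if it holds outside a polar set; random variables equal q.s. are identified. $S_G^0(0,T)=\{h(t,B_{t_1\wedge t},\dots,B_{t_n\wedge t}): t_1,\dots,t_n\in[0,T],\ h\in C_{b,Lip}(\mathbb{R}^{n+1})\}$; $S_G^p(0,T)$ is its completion under $\|\eta\|_{S_G^p}=(\hat{\mathbb{E}}[\sup_{t\in[0,T]}|\eta_t|^p])^{1/p}$. $M_I(0,T)$ (resp. $M_{BV}(0,T)$) is the collection of processes whose paths on $[0,T]$ are, outside a polar set, continuous and increasing (resp. continuous and of bounded variation). Integrals with respect to such processes are pathwise Stieltjes integrals outside a polar set. $p$-admissible constraint pair ($p\ge2$): functions $r,l:[0,T]\times\Omega_T\times\mathbb{R}\to\mathbb{R}$ ($\omega$ suppressed) such that (i) for each fixed $x\in\mathbb{R}$, $r(\cdot,x),l(\cdot,x)$ are continuous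 on $[0,T]$, q.s.; (ii) for any fixed $t\in[0,T]$, $r(t,\cdot)$, $l(t,\cdot)$ are strictly increasing, and $r(t,x)>l(t,x)$ for any $(t,x)\in[0,T]\times\mathbb{R}$, q.s.; (iii) for any $t\in[0,T]$ the inverses $r^{-1}(t,0)$ and $l^{-1}(t,0)$ (the points at which $r(t,\cdot)$, respectively $l(t,\cdot)$, vanish) exist, q.s., the processes $\{r^{-1}(t,0)\}_{t\in[0,T]}$, $\{l^{-1}(t,0)\}_{t\in[0,T]}$ belong to $S_G^p(0,T)$, and $\inf_{(t,\omega)\in[0,T]\times\Omega_T}(l^{-1}(t,\omega,0)-r^{-1}(t,\omega,0))>0$. Reflected problem with constraints $l,r$ for $S\in S_G^p(0,T)$: its solution is the unique pair $(X,A)\in S_G^p(0,T)\times(M_{BV}(0,T)\cap S_G^p(0,T))$ with $X_t=S_t+A_t$, $l(t,X_t)\le0\le r(t,X_t)$ for $t\in[0,T]$, q.s., $A_{0-}=0$, and $A=A^r-A^l$ with $A^r,A^l\in M_I(0,T)\cap S_G^p(0,T)$, $\int_0^Tl(s,X_s)dA^l_s=\int_0^Tr(s,X_s)dA^r_s=0$, q.s. The processes $(A^l,A^r)$ are called the constraining processes. Conventions: $A_{0-}=A^r_{0-}=A^l_{0-}=0$, and the integrals over $[0,T]$ include the possible atoms at time $0$ of sizes $A^r_0,A^l_0$. *)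

theory Defs
  imports "HOL-Probability.Probability"
begin

definition pos_part :: "real \<Rightarrow> real" where
  "pos_part a = max a 0"

definition neg_part :: "real \<Rightarrow> real" where
  "neg_part a = max (- a) 0"


section \<open>Path space\<close>

(* Paths on [0,T] are functions on the reals that are extensional on {0..T}
   (the convention of cfunspace); the distance is the supremum distance. *)
type_synonym path = "real \<Rightarrow> real"
type_synonym rvar = "path \<Rightarrow> real"
type_synonym process = "real \<Rightarrow> path \<Rightarrow> real"

definition path_metric :: "real \<Rightarrow> path metric" where
  "path_metric T =
     submetric (cfunspace (top_of_set {0..T}) (euclidean_metric :: real metric)) {\<omega>. \<omega> 0 = 0}"

definition Omega :: "real \<Rightarrow> path set" where
  "Omega T = mspace (path_metric T)"

lemma Omega_eq:
  "Omega T = {\<omega>. \<omega> \<in> extensional {0..T} \<and> continuous_on {0..T} \<omega> \<and> \<omega> 0 = 0}"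
proof -
  have "Metric_space.mbounded UNIV dist (\<omega> ` {0..T})" if "continuous_on {0..T} \<omega>" for \<omega> :: path
  proof -
    have "bounded (\<omega> ` {0..T})"
      by (intro compact_imp_bounded compact_continuous_image that compact_Icc)
    then show ?thesis
      by (metis Met_TC.mbounded_def bounded_subset_cball mcball_eq_cball subset_UNIV)
  qed
  then show ?thesis
    by (auto simp: Omega_def path_metric_def)
qed

definition path_borel :: "real \<Rightarrow> path measure" where
  "path_borel T = sigma (Omega T) {U. openin (mtopology_of (path_metric T)) U}"

definition path_laws :: "real \<Rightarrow> path measure set" where
  "path_laws T = {P. prob_space P \<and> sets P = sets (path_borel T)}"

definition weak_topology :: "real \<Rightarrow> path measure topology" where
  "weak_topology T = topology_generated_by
     {{P \<in> path_laws T. (\<integral>\<omega>. f \<omega> \<partial>P) \<in> U} | (f :: rvar) U.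
        continuous_map (mtopology_of (path_metric T)) euclideanreal f \<and>
        bounded (f ` Omega T) \<and> open U}"


section \<open>Functions of finitely many real variables\<close>

(* Vectors in R^n are lists of length n. *)
definition lnorm :: "real list \<Rightarrow> real" where
  "lnorm x = L2_set (\<lambda>i. x ! i) {..<length x}"

definition ldist :: "real list \<Rightarrow> real list \<Rightarrow> real" where
  "ldist x y = L2_set (\<lambda>i. x ! i - y ! i) {..<length x}"

definition C_l_Lip :: "nat \<Rightarrow> (real list \<Rightarrow> real) set" where
  "C_l_Lip n = {\<phi>. \<exists>(C::real) (k::nat). \<forall>x y. length x = n \<longrightarrow> length y = n \<longrightarrow>
     \<bar>\<phi> x - \<phi> y\<bar> \<le> C * (1 + lnorm x ^ k + lnorm y ^ k) * ldist x y}"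

definition C_b_Lip :: "nat \<Rightarrow> (real list \<Rightarrow> real) set" where
  "C_b_Lip n = {\<phi>. (\<exists>M. \<forall>x. length x = n \<longrightarrow> \<bar>\<phi> x\<bar> \<le> M) \<and>
     (\<exists>C. \<forall>x y. length x = n \<longrightarrow> length y = n \<longrightarrow> \<bar>\<phi> x - \<phi> y\<bar> \<le> C * ldist x y)}"


section \<open>The G-heat equation\<close>

definition G_fun :: "real \<Rightarrow> real \<Rightarrow> real \<Rightarrow> real" where
  "G_fun \<sigma>l \<sigma>u a = (\<sigma>u\<^sup>2 * pos_part a - \<sigma>l\<^sup>2 * neg_part a) / 2"

(* \<psi> is of class C^{1,2} on (0,T) x R, with the indicated partial derivatives *)
definition C12_with ::
  "real \<Rightarrow> (real \<Rightarrow> real \<Rightarrow> real) \<Rightarrow> (real \<Rightarrow> real \<Rightarrow> real) \<Rightarrow> (real \<Rightarrow> real \<Rightarrow> real)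
     \<Rightarrow> (real \<Rightarrow> real \<Rightarrow> real) \<Rightarrow> bool" where
  "C12_with T \<psi> \<psi>t \<psi>x \<psi>xx \<longleftrightarrow>
     (\<forall>t\<in>{0<..<T}. \<forall>x.
        ((\<lambda>s. \<psi> s x) has_real_derivative \<psi>t t x) (at t) \<and>
        ((\<lambda>y. \<psi> t y) has_real_derivative \<psi>x t x) (at x) \<and>
        ((\<lambda>y. \<psi>x t y) has_real_derivative \<psi>xx t x) (at x)) \<and>
     (\<forall>g\<in>{\<psi>, \<psi>t, \<psi>x, \<psi>xx}. continuous_on ({0<..<T} \<times> UNIV) (\<lambda>(t, x). g t x))"

definition viscosity_subsolution :: "real \<Rightarrow> real \<Rightarrow> real \<Rightarrow> (real \<Rightarrow> real \<Rightarrow> real) \<Rightarrow> bool" where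
  "viscosity_subsolution T \<sigma>l \<sigma>u u \<longleftrightarrow>
     (\<forall>\<psi> \<psi>t \<psi>x \<psi>xx. C12_with T \<psi> \<psi>t \<psi>x \<psi>xx \<longrightarrow> (\<forall>t\<in>{0<..<T}. \<forall>x.
        (\<forall>\<^sub>F (s, y) in nhds (t, x). u s y - \<psi> s y \<le> u t x - \<psi> t x) \<longrightarrow>
        \<psi>t t x - G_fun \<sigma>l \<sigma>u (\<psi>xx t x) \<le> 0))"

definition viscosity_supersolution :: "real \<Rightarrow> real \<Rightarrow> real \<Rightarrow> (real \<Rightarrow> real \<Rightarrow> real) \<Rightarrow> bool" where
  "viscosity_supersolution T \<sigma>l \<sigma>u u \<longleftrightarrow>
     (\<forall>\<psi> \<psi>t \<psi>x \<psi>xx. C12_with T \<psi> \<psi>t \<psi>x \<psi>xx \<longrightarrow> (\<forall>t\<in>{0<..<T}. \<forall>x.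
        (\<forall>\<^sub>F (s, y) in nhds (t, x). u s y - \<psi> s y \<ge> u t x - \<psi> t x) \<longrightarrow>
        \<psi>t t x - G_fun \<sigma>l \<sigma>u (\<psi>xx t x) \<ge> 0))"

(* The polynomial growth bound is the class in which the solution is unique. *)
definition G_heat_solution ::
  "real \<Rightarrow> real \<Rightarrow> real \<Rightarrow> (real \<Rightarrow> real) \<Rightarrow> (real \<Rightarrow> real \<Rightarrow> real) \<Rightarrow> bool" where
  "G_heat_solution T \<sigma>l \<sigma>u \<phi> u \<longleftrightarrow>
     continuous_on ({0..T} \<times> UNIV) (\<lambda>(t, x). u t x) \<and>
     (\<exists>C (k::nat). \<forall>t\<in>{0..T}. \<forall>x. \<bar>u t x\<bar> \<le> C * (1 + \<bar>x\<bar> ^ k)) \<and>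
     (\<forall>x. u 0 x = \<phi> x) \<and>
     viscosity_subsolution T \<sigma>l \<sigma>u u \<and> viscosity_supersolution T \<sigma>l \<sigma>u u"


section \<open>G-expectation\<close>

(* The canonical process is B t \<omega> = \<omega> t. *)
definition L_ip :: "real \<Rightarrow> rvar set" where
  "L_ip T = {\<xi>. \<exists>ts \<phi>. set ts \<subseteq> {0..T} \<and> \<phi> \<in> C_l_Lip (length ts) \<and>
     (\<forall>\<omega>\<in>Omega T. \<xi> \<omega> = \<phi> (map \<omega> ts))}"

definition sublinear_expectation :: "real \<Rightarrow> (rvar \<Rightarrow> real) \<Rightarrow> bool" where
  "sublinear_expectation T E \<longleftrightarrow>
     (\<forall>\<xi>\<in>L_ip T. \<forall>\<zeta>\<in>L_ip T. (\<forall>\<omega>\<in>Omega T. \<xi> \<omega> \<le> \<zeta> \<omega>) \<longrightarrow> E \<xi> \<le> E \<zeta>) \<and>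
     (\<forall>c. E (\<lambda>_. c) = c) \<and>
     (\<forall>\<xi>\<in>L_ip T. \<forall>\<zeta>\<in>L_ip T. E (\<lambda>\<omega>. \<xi> \<omega> + \<zeta> \<omega>) \<le> E \<xi> + E \<zeta>) \<and>
     (\<forall>\<xi>\<in>L_ip T. \<forall>a\<ge>0. E (\<lambda>\<omega>. a * \<xi> \<omega>) = a * E \<xi>)"

definition G_expectation :: "real \<Rightarrow> real \<Rightarrow> real \<Rightarrow> (rvar \<Rightarrow> real) \<Rightarrow> bool" where
  "G_expectation T \<sigma>l \<sigma>u E \<longleftrightarrow>
     sublinear_expectation T E \<and>
     (\<forall>\<phi>\<in>C_l_Lip 1. \<exists>u. G_heat_solution T \<sigma>l \<sigma>u (\<lambda>x. \<phi> [x]) u \<and>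
        (\<forall>s t x. 0 \<le> s \<longrightarrow> s \<le> t \<longrightarrow> t \<le> T \<longrightarrow> E (\<lambda>\<omega>. \<phi> [x + \<omega> t - \<omega> s]) = u (t - s) x)) \<and>
     (\<forall>ts t \<phi>. ts \<noteq> [] \<longrightarrow> sorted (ts @ [t]) \<longrightarrow> set (ts @ [t]) \<subseteq> {0..T} \<longrightarrow>
        \<phi> \<in> C_l_Lip (length ts + 1) \<longrightarrow>
        E (\<lambda>\<omega>. \<phi> (map \<omega> ts @ [\<omega> t - \<omega> (last ts)])) =
        E (\<lambda>\<omega>. E (\<lambda>\<omega>'. \<phi> (map \<omega> ts @ [\<omega>' t - \<omega>' (last ts)]))))"

(* Upper expectation sup_P E_P, as an outer expectation: it is defined for every
   function and does not change if the function is altered on a polar set. *)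
definition upper_E :: "real \<Rightarrow> path measure set \<Rightarrow> (path \<Rightarrow> ennreal) \<Rightarrow> ennreal" where
  "upper_E T \<P> Z =
     (INF Y \<in> {Y \<in> borel_measurable (path_borel T). \<forall>\<omega>\<in>Omega T. Z \<omega> \<le> Y \<omega>}.
        SUP P\<in>\<P>. \<integral>\<^sup>+\<omega>. Y \<omega> \<partial>P)"

(* The completion of L_ip under the L^p norm, realised by random variables. *)
definition L_G :: "real \<Rightarrow> path measure set \<Rightarrow> real \<Rightarrow> rvar set" where
  "L_G T \<P> p = {\<xi> \<in> borel_measurable (path_borel T). \<exists>\<xi>n. (\<forall>n. \<xi>n n \<in> L_ip T) \<and>
     (\<lambda>n::nat. upper_E T \<P> (\<lambda>\<omega>. ennreal (\<bar>\<xi> \<omega> - \<xi>n n \<omega>\<bar> powr p))) \<longlonglongrightarrow> 0}"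

definition represents :: "real \<Rightarrow> path measure set \<Rightarrow> (rvar \<Rightarrow> real) \<Rightarrow> bool" where
  "represents T \<P> E \<longleftrightarrow>
     (\<forall>\<xi>\<in>L_G T \<P> 1. (\<forall>P\<in>\<P>. integrable P \<xi>) \<and> bdd_above ((\<lambda>P. \<integral>\<omega>. \<xi> \<omega> \<partial>P) ` \<P>) \<and>
        E \<xi> = (SUP P\<in>\<P>. \<integral>\<omega>. \<xi> \<omega> \<partial>P))"

(* E is the G-expectation together with its extension to the completion of L_ip. *)
definition G_framework ::
  "real \<Rightarrow> real \<Rightarrow> real \<Rightarrow> (rvar \<Rightarrow> real) \<Rightarrow> path measure set \<Rightarrow> bool" where
  "G_framework T \<sigma>l \<sigma>u E \<P> \<longleftrightarrow>
     0 < T \<and> 0 \<le> \<sigma>l\<^sup>2 \<and> \<sigma>l\<^sup>2 < \<sigma>u\<^sup>2 \<and> G_expectation T \<sigma>l \<sigma>u E \<and>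
     \<P> \<subseteq> path_laws T \<and> compactin (weak_topology T) \<P> \<and> represents T \<P> E"

definition polar :: "real \<Rightarrow> path measure set \<Rightarrow> path set \<Rightarrow> bool" where
  "polar T \<P> N \<longleftrightarrow> N \<in> sets (path_borel T) \<and> (SUP P\<in>\<P>. emeasure P N) = 0"

definition qs :: "real \<Rightarrow> path measure set \<Rightarrow> (path \<Rightarrow> bool) \<Rightarrow> bool" where
  "qs T \<P> \<Phi> \<longleftrightarrow> (\<exists>N. polar T \<P> N \<and> (\<forall>\<omega>\<in>Omega T - N. \<Phi> \<omega>))"


section \<open>Spaces of processes\<close>

definition S_G0 :: "real \<Rightarrow> process set" where
  "S_G0 T = {\<eta>. \<exists>ts h. set ts \<subseteq> {0..T} \<and> h \<in> C_b_Lip (length ts + 1) \<and>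
     (\<forall>t\<in>{0..T}. \<forall>\<omega>\<in>Omega T. \<eta> t \<omega> = h (t # map (\<lambda>u. \<omega> (min u t)) ts))}"

(* The completion of S_G0, realised by processes (every q.s. modification of a
   member is again a member); the p-th power of the norm is used. *)
definition S_G :: "real \<Rightarrow> path measure set \<Rightarrow> real \<Rightarrow> process set" where
  "S_G T \<P> p = {\<eta>. \<exists>\<eta>n. (\<forall>n. \<eta>n n \<in> S_G0 T) \<and>
     (\<lambda>n::nat. upper_E T \<P> (\<lambda>\<omega>. SUP t\<in>{0..T}. ennreal (\<bar>\<eta> t \<omega> - \<eta>n n t \<omega>\<bar> powr p)))
       \<longlonglongrightarrow> 0}"

definition M_I :: "real \<Rightarrow> path measure set \<Rightarrow> process set" where
  "M_I T \<P> = {A. qs T \<P> (\<lambda>\<omega>. continuous_on {0..T} (\<lambda>t. A t \<omega>) \<and> mono_on {0..T} (\<lambda>t. A t \<omega>))}"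

definition bounded_variation_on :: "real \<Rightarrow> (real \<Rightarrow> real) \<Rightarrow> bool" where
  "bounded_variation_on T f \<longleftrightarrow>
     (\<exists>V. \<forall>(n::nat) \<tau>. mono \<tau> \<longrightarrow> range \<tau> \<subseteq> {0..T} \<longrightarrow>
        (\<Sum>i<n. \<bar>f (\<tau> (Suc i)) - f (\<tau> i)\<bar>) \<le> V)"

definition M_BV :: "real \<Rightarrow> path measure set \<Rightarrow> process set" where
  "M_BV T \<P> =
     {A. qs T \<P> (\<lambda>\<omega>. continuous_on {0..T} (\<lambda>t. A t \<omega>) \<and> bounded_variation_on T (\<lambda>t. A t \<omega>))}"

(* The Stieltjes measure dA on [0,T] under the convention A_{0-} = 0: it has an
   atom of size A 0 at time 0 and does not charge the complement of [0,T]. *)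
definition stieltjes :: "real \<Rightarrow> (real \<Rightarrow> real) \<Rightarrow> real measure" where
  "stieltjes T A = interval_measure (\<lambda>s. if s < 0 then 0 else A (min s T))"


section \<open>Reflected problem\<close>

(* The exceptional polar set does not depend on t or x. In the last condition
   rinv and linv are the inverses of r(t,.) and l(t,.) at 0, which are determined
   outside a polar set by strict monotonicity; on the polar set their values are free. *)
definition admissible_pair ::
  "real \<Rightarrow> path measure set \<Rightarrow> real \<Rightarrow> (real \<Rightarrow> path \<Rightarrow> real \<Rightarrow> real)
     \<Rightarrow> (real \<Rightarrow> path \<Rightarrow> real \<Rightarrow> real) \<Rightarrow> bool" where
  "admissible_pair T \<P> p l r \<longleftrightarrow>
     qs T \<P> (\<lambda>\<omega>. \<forall>x. continuous_on {0..T} (\<lambda>t. r t \<omega> x) \<and> continuous_on {0..T} (\<lambda>t. l t \<omega> x)) \<and>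
     qs T \<P> (\<lambda>\<omega>. \<forall>t\<in>{0..T}. strict_mono (r t \<omega>) \<and> strict_mono (l t \<omega>) \<and>
                  (\<forall>x. r t \<omega> x > l t \<omega> x)) \<and>
     (\<exists>rinv linv. qs T \<P> (\<lambda>\<omega>. \<forall>t\<in>{0..T}. r t \<omega> (rinv t \<omega>) = 0 \<and> l t \<omega> (linv t \<omega>) = 0) \<and>
        rinv \<in> S_G T \<P> p \<and> linv \<in> S_G T \<P> p \<and>
        (INF (t, \<omega>) \<in> {0..T} \<times> Omega T. ereal (linv t \<omega> - rinv t \<omega>)) > 0)"

(* (X, A) solves the reflected problem for S, with constraining processes Al, Ar.
   As A_{0-} = 0, monotonicity of Al and Ar includes nonnegativity at time 0. *)
definition reflected_solution ::
  "real \<Rightarrow> path measure set \<Rightarrow> real \<Rightarrow> (real \<Rightarrow> path \<Rightarrow> real \<Rightarrow> real)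
     \<Rightarrow> (real \<Rightarrow> path \<Rightarrow> real \<Rightarrow> real) \<Rightarrow> process
     \<Rightarrow> process \<Rightarrow> process \<Rightarrow> process \<Rightarrow> process \<Rightarrow> bool" where
  "reflected_solution T \<P> p l r S X A Al Ar \<longleftrightarrow>
     X \<in> S_G T \<P> p \<and> A \<in> M_BV T \<P> \<inter> S_G T \<P> p \<and>
     Al \<in> M_I T \<P> \<inter> S_G T \<P> p \<and> Ar \<in> M_I T \<P> \<inter> S_G T \<P> p \<and>
     qs T \<P> (\<lambda>\<omega>. 0 \<le> Al 0 \<omega> \<and> 0 \<le> Ar 0 \<omega>) \<and>
     qs T \<P> (\<lambda>\<omega>. \<forall>t\<in>{0..T}. X t \<omega> = S t \<omega> + A t \<omega>) \<and>
     qs T \<P> (\<lambda>\<omega>. \<forall>t\<in>{0..T}. l t \<omega> (X t \<omega>) \<le> 0 \<and> 0 \<le> r t \<omega> (X t \<omega>)) \<and>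
     qs T \<P> (\<lambda>\<omega>. \<forall>t\<in>{0..T}. A t \<omega> = Ar t \<omega> - Al t \<omega>) \<and>
     qs T \<P> (\<lambda>\<omega>.
       has_bochner_integral (stieltjes T (\<lambda>t. Al t \<omega>))
         (\<lambda>s. indicator {0..T} s * l s \<omega> (X s \<omega>)) 0 \<and>
       has_bochner_integral (stieltjes T (\<lambda>t. Ar t \<omega>))
         (\<lambda>s. indicator {0..T} s * r s \<omega> (X s \<omega>)) 0)"

end

theory Submission
  imports Defs
begin

text \<open>
  The statement is a comparison of two deterministic two-barrier problems, path by path.
  Off a polar set, \<open>X\<close> and \<open>X'\<close> live between the same continuous barriers
  \<open>\<alpha> = r\<^sup>-\<^sup>1(t,0)\<close> and \<open>\<beta> = l\<^sup>-\<^sup>1(t,0)\<close>, the upward pushes \<open>Ar\<close>, \<open>Ar'\<close> act only at times when the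
  respective path is at \<open>\<alpha>\<close>, the downward pushes \<open>Al\<close>, \<open>Al'\<close> only when it is at \<open>\<beta>\<close>, and with
  \<open>c = c0 - c0'\<close>
  \[ X - X' = c + \<nu> + (Ar - Ar') - (Al - Al'). \]

  Suppose that \<open>Ar'\<close> exceeds \<open>Ar + \<nu> + c\<^sup>+\<close> somewhere. Since the latter is nondecreasing, the excess
  must have been produced by an actual increase of \<open>Ar'\<close>, so at or before that time there is
  a time of excess at which \<open>X' = \<alpha> \<le> X\<close> (lemma \<open>overtaking_time\<close>). At that time the identity
  forces \<open>Al'\<close> to exceed \<open>Al + c\<^sup>-\<close>. By the same reasoning there is, at or before
  it, a time of excess of \<open>Al'\<close> at which \<open>X' = \<beta> \<ge> X\<close>, which in turn forces an excess of \<open>Ar'\<close>. Hence the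
  times of excess at the lower barrier and those at the upper barrier have the same infimum, and
  by continuity of \<open>X'\<close>, \<open>\<alpha>\<close>, \<open>\<beta>\<close> at this infimum \<open>X'\<close> is at both barriers at once, which is
  impossible (lemma \<open>alternating_domination\<close>). The remaining two bounds follow in the same way from the
  increases of \<open>Ar\<close> and \<open>Al\<close>.

  The only probabilistic ingredient is that members of \<open>S_G\<close> have continuous paths outside a polar
  set (lemma \<open>S_G_qs_continuous\<close>), which is needed for \<open>X\<close>, \<open>X'\<close>, \<open>\<nu>\<close> and the barriers.
\<close>

section \<open>Quasi-sure events\<close>

lemma polar_iff:
  "polar T \<P> N \<longleftrightarrow> N \<in> sets (path_borel T) \<and> (\<forall>P\<in>\<P>. emeasure P N = 0)"
  unfolding polar_def bot_ennreal[symmetric] SUP_bot_conv ..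

lemma qs_mono:
  assumes "qs T \<P> \<Phi>" and "\<And>\<omega>. \<omega> \<in> Omega T \<Longrightarrow> \<Phi> \<omega> \<Longrightarrow> \<Psi> \<omega>"
  shows "qs T \<P> \<Psi>"
  using assms unfolding qs_def by blast

lemma qs_conj:
  assumes laws: "\<P> \<subseteq> path_laws T" and "qs T \<P> \<Phi>" and "qs T \<P> \<Psi>"
  shows "qs T \<P> (\<lambda>\<omega>. \<Phi> \<omega> \<and> \<Psi> \<omega>)"
proof -
  obtain M N where M: "polar T \<P> M" "\<forall>\<omega>\<in>Omega T - M. \<Phi> \<omega>"
    and N: "polar T \<P> N" "\<forall>\<omega>\<in>Omega T - N. \<Psi> \<omega>"
    using assms unfolding qs_def by blast
  have "emeasure P (M \<union> N) = 0" if "P \<in> \<P>" for P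
  proof -
    have "sets P = sets (path_borel T)"
      using laws that by (auto simp: path_laws_def)
    then have "M \<in> null_sets P" "N \<in> null_sets P"
      using M(1) N(1) that by (auto simp: polar_iff null_sets_def)
    then show ?thesis
      by (metis null_sets.Un null_setsD1)
  qed
  then have "polar T \<P> (M \<union> N)"
    using M(1) N(1) by (auto simp: polar_iff)
  then show ?thesis
    using M(2) N(2) unfolding qs_def by blast
qed


section \<open>Path continuity of members of the completion\<close>

lemma C_b_Lip_continuous_compose:
  assumes h: "h \<in> C_b_Lip (length fs)"
    and fs: "\<And>f. f \<in> set fs \<Longrightarrow> continuous_on I f"
  shows "continuous_on (I :: real set) (\<lambda>t. h (map (\<lambda>f. f t) fs))"
  unfolding continuous_on_def
proof
  fix s assume s: "s \<in> I"
  let ?v = "\<lambda>t. map (\<lambda>f. f t :: real) fs"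
  let ?d = "\<lambda>t. \<Sum>i<length fs. \<bar>(fs ! i) t - (fs ! i) s\<bar>"
  obtain C where C: "\<And>x y. length x = length fs \<Longrightarrow> length y = length fs
      \<Longrightarrow> \<bar>h x - h y\<bar> \<le> C * ldist x y"
    using h unfolding C_b_Lip_def by blast
  have bound: "\<bar>h (?v t) - h (?v s)\<bar> \<le> \<bar>C\<bar> * ?d t" for t
  proof -
    have eq: "ldist (?v t) (?v s) = L2_set (\<lambda>i. (fs ! i) t - (fs ! i) s) {..<length fs}"
      unfolding ldist_def by (intro L2_set_cong) auto
    have "\<bar>h (?v t) - h (?v s)\<bar> \<le> C * ldist (?v t) (?v s)"
      by (rule C) auto
    also have "\<dots> \<le> \<bar>C\<bar> * ldist (?v t) (?v s)"
      unfolding eq by (intro mult_right_mono L2_set_nonneg) auto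
    also have "\<dots> \<le> \<bar>C\<bar> * ?d t"
      unfolding eq by (intro mult_left_mono L2_set_le_sum_abs) auto
    finally show ?thesis .
  qed
  have lim: "((fs ! i) \<longlongrightarrow> (fs ! i) s) (at s within I)" if "i < length fs" for i
    using fs[OF nth_mem[OF that]] s unfolding continuous_on_def by simp
  have "((\<lambda>t. \<bar>C\<bar> * ?d t) \<longlongrightarrow> \<bar>C\<bar> * (\<Sum>i<length fs. \<bar>(fs ! i) s - (fs ! i) s\<bar>)) (at s within I)"
    by (intro tendsto_mult_left tendsto_sum tendsto_rabs tendsto_diff lim tendsto_const) simp
  then have "((\<lambda>t. \<bar>C\<bar> * ?d t) \<longlongrightarrow> 0) (at s within I)"
    by simp
  moreover have "\<forall>\<^sub>F t in at s within I. norm (h (?v t) - h (?v s)) \<le> \<bar>C\<bar> * ?d t"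
    using bound by (intro always_eventually) simp
  ultimately have "((\<lambda>t. h (?v t) - h (?v s)) \<longlongrightarrow> 0) (at s within I)"
    by (rule Lim_null_comparison[rotated])
  then show "((\<lambda>t. h (?v t)) \<longlongrightarrow> h (?v s)) (at s within I)"
    by (rule LIM_zero_cancel)
qed

lemma S_G0_continuous:
  assumes "\<eta> \<in> S_G0 T" and \<omega>: "\<omega> \<in> Omega T"
  shows "continuous_on {0..T} (\<lambda>t. \<eta> t \<omega>)"
proof -
  obtain ts h where ts: "set ts \<subseteq> {0..T}" and h: "h \<in> C_b_Lip (length ts + 1)"
    and eq: "\<And>t. t \<in> {0..T} \<Longrightarrow> \<eta> t \<omega> = h (t # map (\<lambda>u. \<omega> (min u t)) ts)"
    using assms unfolding S_G0_def by blast
  let ?fs = "(\<lambda>t. t) # map (\<lambda>u t. \<omega> (min u t)) ts"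
  have \<omega>cont: "continuous_on {0..T} \<omega>"
    using \<omega> by (simp add: Omega_eq)
  have "continuous_on {0..T} (\<lambda>t. h (map (\<lambda>f. f t) ?fs))"
  proof (rule C_b_Lip_continuous_compose)
    fix f assume "f \<in> set ?fs"
    then consider "f = (\<lambda>t. t)" | u where "u \<in> {0..T}" "f = (\<lambda>t. \<omega> (min u t))"
      using ts by auto
    then show "continuous_on {0..T} f"
    proof cases
      case 2
      have "continuous_on {0..T} (\<lambda>t. min u t)"
        by (intro continuous_intros)
      moreover have "min u ` {0..T} \<subseteq> {0..T}"
        using 2(1) by (auto simp: min_def)
      ultimately show ?thesis
        unfolding 2(2) by (rule continuous_on_compose2[OF \<omega>cont])
    qed simp
  qed (use h in auto)
  moreover have "h (map (\<lambda>f. f t) ?fs) = \<eta> t \<omega>" if "t \<in> {0..T}" for t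
    unfolding eq[OF that] by (simp add: comp_def)
  ultimately show ?thesis
    by (rule continuous_on_eq)
qed

lemma continuous_on_uniformly_approximable:
  fixes f :: "real \<Rightarrow> real"
  assumes "\<And>e. 0 < e \<Longrightarrow> \<exists>g. continuous_on I g \<and> (\<forall>t\<in>I. \<bar>f t - g t\<bar> < e)"
  shows "continuous_on I f"
proof -
  have "\<exists>g. continuous_on I g \<and> (\<forall>t\<in>I. \<bar>f t - g t\<bar> < inverse (real (Suc n)))" for n
    by (rule assms) simp
  then obtain g where g: "\<And>n. continuous_on I (g n)"
    "\<And>n t. t \<in> I \<Longrightarrow> \<bar>f t - g n t\<bar> < inverse (real (Suc n))"
    by metis
  have "uniform_limit I g f sequentially"
    unfolding uniform_limit_iff
  proof (intro allI impI)
    fix e :: real assume "0 < e"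
    then have "\<forall>\<^sub>F n in sequentially. inverse (real (Suc n)) < e"
      by (rule order_tendstoD(2)[OF LIMSEQ_inverse_real_of_nat])
    then show "\<forall>\<^sub>F n in sequentially. \<forall>t\<in>I. dist (g n t) (f t) < e"
    proof eventually_elim
      case (elim n)
      show ?case
      proof
        fix t assume "t \<in> I"
        from less_trans[OF g(2)[OF this] elim] show "dist (g n t) (f t) < e"
          by (simp add: dist_real_def abs_minus_commute)
      qed
    qed
  qed
  from uniform_limit_theorem[OF _ this] g(1) show ?thesis
    by simp
qed

text \<open>
  Membership only provides approximation in the mean. Choosing measurable dominators \<open>Y n\<close> of
  the sup-distances whose upper expectations vanish, Fatou's lemma under each law gives
  \<open>liminf Y = 0\<close> almost surely, and the set where this fails does not depend on the law. A vanishing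
  lower limit along the sequence is all that a uniform limit argument needs.
\<close>
lemma S_G_qs_continuous:
  assumes laws: "\<P> \<subseteq> path_laws T" and p: "0 < p" and \<eta>: "\<eta> \<in> S_G T \<P> p"
  shows "qs T \<P> (\<lambda>\<omega>. continuous_on {0..T} (\<lambda>t. \<eta> t \<omega>))"
proof -
  obtain \<eta>n where \<eta>n: "\<And>n::nat. \<eta>n n \<in> S_G0 T"
    and lim: "(\<lambda>n. upper_E T \<P> (\<lambda>\<omega>. SUP t\<in>{0..T}. ennreal (\<bar>\<eta> t \<omega> - \<eta>n n t \<omega>\<bar> powr p)))
       \<longlonglongrightarrow> 0"
    using \<eta> unfolding S_G_def by blast
  let ?D = "\<lambda>n \<omega>. SUP t\<in>{0..T}. ennreal (\<bar>\<eta> t \<omega> - \<eta>n n t \<omega>\<bar> powr p)"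
  define dominates where "dominates k n Y \<longleftrightarrow> Y \<in> borel_measurable (path_borel T) \<and>
      (\<forall>\<omega>\<in>Omega T. ?D n \<omega> \<le> Y \<omega>) \<and>
      (SUP P\<in>\<P>. \<integral>\<^sup>+\<omega>. Y \<omega> \<partial>P) < ennreal (inverse (real (Suc k)))" for k n Y
  have "\<exists>n Y. dominates k n Y" for k
  proof -
    have "0 < ennreal (inverse (real (Suc k)))"
      by simp
    from order_tendstoD(2)[OF lim this]
    obtain n where "upper_E T \<P> (?D n) < ennreal (inverse (real (Suc k)))"
      by (auto simp: eventually_sequentially)
    then show ?thesis
      unfolding upper_E_def INF_less_iff dominates_def by blast
  qed
  then obtain n Y where "\<And>k. dominates k (n k) (Y k)"
    by metis
  then have Y: "\<And>k. Y k \<in> borel_measurable (path_borel T)"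
    and DY: "\<And>k \<omega>. \<omega> \<in> Omega T \<Longrightarrow> ?D (n k) \<omega> \<le> Y k \<omega>"
    and EY: "\<And>k. (SUP P\<in>\<P>. \<integral>\<^sup>+\<omega>. Y k \<omega> \<partial>P) < ennreal (inverse (real (Suc k)))"
    unfolding dominates_def by blast+
  let ?L = "\<lambda>\<omega>. liminf (\<lambda>k. Y k \<omega>)"
  define N where "N = {\<omega> \<in> space (path_borel T). ?L \<omega> \<noteq> 0}"
  have L: "?L \<in> borel_measurable (path_borel T)"
    by (rule borel_measurable_liminf) (rule Y)
  have "emeasure P N = 0" if P: "P \<in> \<P>" for P
  proof -
    have sets: "sets P = sets (path_borel T)"
      using laws P by (auto simp: path_laws_def)
    have meas: "f \<in> borel_measurable P \<longleftrightarrow> f \<in> borel_measurable (path_borel T)" for f :: "path \<Rightarrow> ennreal"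
      using measurable_cong_sets[OF sets refl] by blast
    have bound: "(\<integral>\<^sup>+\<omega>. Y k \<omega> \<partial>P) \<le> ennreal (inverse (real (Suc k)))" for k
      by (rule order_trans[OF SUP_upper[OF P] less_imp_le[OF EY]])
    have lim0: "(\<lambda>k. ennreal (inverse (real (Suc k)))) \<longlonglongrightarrow> 0"
      using tendsto_ennrealI[OF LIMSEQ_inverse_real_of_nat] by (simp only: ennreal_0)
    have "(\<lambda>k. \<integral>\<^sup>+\<omega>. Y k \<omega> \<partial>P) \<longlonglongrightarrow> 0"
      by (rule tendsto_sandwich[OF _ _ tendsto_const lim0])
        (rule always_eventually, rule allI, rule zero_le bound)+
    then have "liminf (\<lambda>k. \<integral>\<^sup>+\<omega>. Y k \<omega> \<partial>P) = 0"
      by (rule lim_imp_Liminf[OF trivial_limit_sequentially])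
    moreover have "(\<integral>\<^sup>+\<omega>. ?L \<omega> \<partial>P) \<le> liminf (\<lambda>k. \<integral>\<^sup>+\<omega>. Y k \<omega> \<partial>P)"
      by (rule nn_integral_liminf) (simp only: meas Y)
    ultimately have "(\<integral>\<^sup>+\<omega>. ?L \<omega> \<partial>P) = 0"
      by simp
    then have "emeasure P {\<omega> \<in> space P. ?L \<omega> \<noteq> 0} = 0"
      using nn_integral_0_iff[of ?L P] L by (simp only: meas)
    then show ?thesis
      by (simp only: N_def sets_eq_imp_space_eq[OF sets])
  qed
  moreover have "N \<in> sets (path_borel T)"
    unfolding N_def by (intro borel_measurable_neq L borel_measurable_const)
  ultimately have "polar T \<P> N"
    by (simp add: polar_iff)
  moreover have "continuous_on {0..T} (\<lambda>t. \<eta> t \<omega>)" if \<omega>: "\<omega> \<in> Omega T - N" for \<omega>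
  proof (rule continuous_on_uniformly_approximable)
    fix e :: real assume e: "0 < e"
    have "space (path_borel T) = Omega T"
      unfolding path_borel_def by (subst space_measure_of) (use openin_subset in \<open>force simp: Omega_def\<close>)+
    then have "?L \<omega> = 0"
      using \<omega> by (auto simp: N_def)
    then have "?L \<omega> < ennreal (e powr p)"
      using e by simp
    moreover have "ennreal (e powr p) \<le> ?L \<omega>" if "\<And>k. ennreal (e powr p) \<le> Y k \<omega>"
      using that by (intro Liminf_bounded always_eventually) blast
    ultimately obtain k where k: "Y k \<omega> < ennreal (e powr p)"
      by (meson not_less)
    have "\<bar>\<eta> t \<omega> - \<eta>n (n k) t \<omega>\<bar> < e" if t: "t \<in> {0..T}" for t
    proof -
      have "ennreal (\<bar>\<eta> t \<omega> - \<eta>n (n k) t \<omega>\<bar> powr p) \<le> ?D (n k) \<omega>"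
        using t by (rule SUP_upper)
      also have "\<dots> \<le> Y k \<omega>"
        using DY \<omega> by auto
      also note k
      finally have "\<bar>\<eta> t \<omega> - \<eta>n (n k) t \<omega>\<bar> powr p < e powr p"
        by (simp add: ennreal_less_iff)
      then show ?thesis
        using e p by (meson abs_ge_zero not_less powr_mono2 less_imp_le)
    qed
    then show "\<exists>g. continuous_on {0..T} g \<and> (\<forall>t\<in>{0..T}. \<bar>\<eta> t \<omega> - g t\<bar> < e)"
      using S_G0_continuous[OF \<eta>n] \<omega> by blast
  qed
  ultimately show ?thesis
    unfolding qs_def by blast
qed


section \<open>Where a Stieltjes measure is concentrated\<close>

lemma emeasure_stieltjes_Ioc:
  assumes T: "0 \<le> T" and K: "continuous_on {0..T} K" "mono_on {0..T} K" "0 \<le> K 0"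
    and "a \<le> b"
  shows "emeasure (stieltjes T K) {a<..b} =
    ennreal ((if b < 0 then 0 else K (min b T)) - (if a < 0 then 0 else K (min a T)))"
  unfolding stieltjes_def
proof (rule emeasure_interval_measure_Ioc[OF \<open>a \<le> b\<close>])
  let ?F = "\<lambda>s. if s < 0 then 0 else K (min s T)"
  fix x y :: real assume "x \<le> y"
  moreover have "K 0 \<le> K (min y T)" if "0 \<le> y"
    using T that by (intro mono_onD[OF K(2)]) auto
  moreover have "K (min x T) \<le> K (min y T)" if "0 \<le> x"
    using T that \<open>x \<le> y\<close> by (intro mono_onD[OF K(2)]) auto
  ultimately show "?F x \<le> ?F y"
    using K(3) by auto
next
  let ?F = "\<lambda>s. if s < 0 then 0 else K (min s T)"
  fix x :: real
  show "continuous (at_right x) ?F"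
  proof (cases "x < 0")
    case True
    have "((\<lambda>_. 0) \<longlongrightarrow> 0) (at_right x)"
      by simp
    moreover have "\<forall>\<^sub>F s in at_right x. 0 = ?F s"
      using eventually_at_right_real[OF True] by eventually_elim auto
    ultimately show ?thesis
      using True unfolding continuous_within by (auto intro: Lim_transform_eventually)
  next
    case False
    have "continuous_on {0..} (\<lambda>s. K (min s T))"
      using T by (intro continuous_on_compose2[OF K(1)] continuous_intros) auto
    then have "((\<lambda>s. K (min s T)) \<longlongrightarrow> K (min x T)) (at x within {0..})"
      using False by (auto simp: continuous_on_def)
    then have "((\<lambda>s. K (min s T)) \<longlongrightarrow> K (min x T)) (at_right x)"
      by (rule tendsto_within_subset) (use False in auto)
    moreover have "\<forall>\<^sub>F s in at_right x. K (min s T) = ?F s"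
      using False unfolding eventually_at_filter by (auto intro!: always_eventually)
    ultimately show ?thesis
      using False unfolding continuous_within by (auto intro: Lim_transform_eventually)
  qed
qed

lemma sets_stieltjes [measurable_cong, simp]: "sets (stieltjes T K) = sets borel"
  by (simp add: stieltjes_def)

lemma emeasure_stieltjes_eq_0:
  assumes "AE s in stieltjes T K. s \<notin> {a<..b}"
  shows "emeasure (stieltjes T K) {a<..b} = 0"
proof -
  have "{s \<in> space (stieltjes T K). s \<in> {a<..b}} = {a<..b}"
    by (auto simp: stieltjes_def)
  then show ?thesis
    using emeasure_eq_0_AE[OF assms] by (simp only:)
qed

text \<open>
  The form in which the complementarity conditions are used: where \<open>K\<close> increases, there is a time at
  which the path is at the barrier.
\<close>
lemma AE_stieltjes_increase:
  assumes K: "continuous_on {0..T} K" "mono_on {0..T} K" "0 \<le> K 0"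
    and AE: "AE s in stieltjes T K. s \<in> {0..T} \<longrightarrow> Q s"
    and ab: "0 \<le> a" "a \<le> b" "b \<le> T" "K a < K b"
  shows "\<exists>s\<in>{a<..b}. Q s"
proof (rule ccontr)
  assume no: "\<not> ?thesis"
  have "AE s in stieltjes T K. s \<notin> {a<..b}"
    using AE by eventually_elim (use no ab in auto)
  then have "emeasure (stieltjes T K) {a<..b} = 0"
    by (rule emeasure_stieltjes_eq_0)
  moreover have "emeasure (stieltjes T K) {a<..b} = ennreal (K b - K a)"
    using ab by (subst emeasure_stieltjes_Ioc[OF _ K]) (auto simp: min_def)
  ultimately show False
    using ab by (simp add: ennreal_eq_0_iff)
qed

text \<open>
  The mass \<open>K 0\<close> of \<open>{-1<..0}\<close> sits at the single point \<open>0\<close>, because the distribution function is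
  constant to the left of \<open>0\<close>. So a property that holds almost everywhere cannot fail there.
\<close>
lemma AE_stieltjes_initial_atom:
  assumes T: "0 \<le> T" and K: "continuous_on {0..T} K" "mono_on {0..T} K" "0 < K 0"
    and AE: "AE s in stieltjes T K. s \<in> {0..T} \<longrightarrow> Q s"
  shows "Q 0"
proof (rule ccontr)
  assume nQ: "\<not> Q 0"
  have "AE s in stieltjes T K. s \<notin> {-1<..- inverse (real (Suc n))}" for n
  proof -
    have "emeasure (stieltjes T K) {-1<..- inverse (real (Suc n))} = 0"
      using K(3) by (subst emeasure_stieltjes_Ioc[OF T K(1,2)]) (auto simp: inverse_le_1_iff)
    then show ?thesis
      by (intro AE_not_in) (auto simp: null_sets_def)
  qed
  then have "AE s in stieltjes T K. \<forall>n. s \<notin> {-1<..- inverse (real (Suc n))}"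
    unfolding AE_all_countable by blast
  then have "AE s in stieltjes T K. s \<notin> {-1<..0}"
    using AE
  proof eventually_elim
    case (elim s)
    have False if s: "-1 < s" "s < 0"
    proof -
      obtain n where "inverse (real (Suc n)) < - s"
        using reals_Archimedean[of "- s"] s(2) unfolding neg_0_less_iff_less by blast
      then show False
        using elim(1)[rule_format, of n] s(1) by simp
    qed
    moreover have "s \<noteq> 0"
      using elim(2) nQ T by auto
    ultimately show ?case
      by force
  qed
  then have "emeasure (stieltjes T K) {-1<..0} = 0"
    by (rule emeasure_stieltjes_eq_0)
  moreover have "emeasure (stieltjes T K) {-1<..0} = ennreal (K 0)"
    using T K(3) by (subst emeasure_stieltjes_Ioc[OF T K(1,2)]) (auto simp: min_def)
  ultimately show False
    using K(3) by (simp add: ennreal_eq_0_iff)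
qed

lemma has_bochner_integral_nonneg_zero_AE:
  fixes f :: "'a \<Rightarrow> real"
  assumes "has_bochner_integral M f 0" and "\<And>x. 0 \<le> f x"
  shows "AE x in M. f x = 0"
  using assms integral_nonneg_eq_0_iff_AE[of M f]
  by (auto simp: has_bochner_integral_iff)


section \<open>The pathwise comparison\<close>

text \<open>
  The excess of \<open>K\<close> over the nondecreasing function \<open>H\<close> is created either by an increase of \<open>K\<close> after
  the last time at which \<open>K \<le> H\<close>, or, if there is no such time, by the atom at time \<open>0\<close>.
  In both cases the Stieltjes measure of \<open>K\<close> charges times of excess.
\<close>
lemma overtaking_time:
  assumes K: "continuous_on {0..T} K" "mono_on {0..T} K" "0 \<le> K 0"
    and H: "continuous_on {0..T} H" "mono_on {0..T} H" "0 \<le> H 0"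
    and AE: "AE s in stieltjes T K. s \<in> {0..T} \<longrightarrow> Q s"
    and t: "t \<in> {0..T}" "H t < K t"
  shows "\<exists>u\<in>{0..t}. Q u \<and> H u < K u"
proof (cases "\<exists>s\<in>{0..t}. K s \<le> H s")
  case False
  then have "H 0 < K 0"
    using t by (metis atLeastAtMost_iff not_less order_refl)
  then show ?thesis
    using AE_stieltjes_initial_atom[OF _ K(1,2) _ AE] H(3) t(1) by (intro bexI[of _ 0]) auto
next
  case True
  let ?Z = "{s\<in>{0..t}. K s \<le> H s}"
  have sub: "{0..t} \<subseteq> {0..T}"
    using t(1) by auto
  have "compact ?Z"
  proof -
    have "closed ?Z"
      by (intro continuous_on_closed_Collect_le continuous_on_subset[OF K(1) sub]
          continuous_on_subset[OF H(1) sub]) auto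
    moreover have "bounded ?Z"
      by (rule bounded_subset[OF compact_imp_bounded[OF compact_Icc[of 0 t]]]) auto
    ultimately show ?thesis
      by (simp only: compact_eq_bounded_closed)
  qed
  from compact_attains_sup[OF this] True
  obtain s where s: "s \<in> ?Z" and last: "\<And>v. v \<in> ?Z \<Longrightarrow> v \<le> s"
    by (metis (mono_tags, lifting) empty_Collect_eq)
  have "H s \<le> H t"
    using s t(1) by (intro mono_onD[OF H(2)]) auto
  then have "K s < K t"
    using s t(2) by auto
  then obtain u where u: "u \<in> {s<..t}" "Q u"
    using AE_stieltjes_increase[OF K AE, of s t] s t(1) by (auto simp del: greaterThanAtMost_iff)
  then have "u \<in> {0..t}"
    using s by auto
  moreover have "H u < K u"
    using last[of u] u(1) s by (metis (mono_tags, lifting) \<open>u \<in> {0..t}\<close> greaterThanAtMost_iff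
        mem_Collect_eq not_less)
  ultimately show ?thesis
    using u(2) by blast
qed

text \<open>
  Below every excess of one kind lies an excess of the other kind, so excesses located in \<open>Z1\<close> and
  those located in \<open>Z2\<close> are coinitial: they have the same infimum, which would have to belong to both
  of the disjoint closed sets.
\<close>
lemma alternating_domination:
  fixes V1 V2 Z1 Z2 :: "real set"
  assumes closed: "closed Z1" "closed Z2" and disj: "Z1 \<inter> Z2 = {}"
    and V: "V1 \<subseteq> {0..}" "V2 \<subseteq> {0..}"
    and down1: "\<And>t. t \<in> V1 \<Longrightarrow> \<exists>u\<le>t. u \<in> V1 \<inter> Z1"
    and down2: "\<And>t. t \<in> V2 \<Longrightarrow> \<exists>u\<le>t. u \<in> V2 \<inter> Z2"
    and cross: "V1 \<inter> Z1 \<subseteq> V2" "V2 \<inter> Z2 \<subseteq> V1"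
  shows "V1 = {} \<and> V2 = {}"
proof (rule ccontr)
  assume nonempty: "\<not> (V1 = {} \<and> V2 = {})"
  \<comment> \<open>An excess in \<open>Z1\<close> is also an excess of the second kind, hence has one in \<open>Z2\<close> at or below it; and conversely.\<close>
  have below1: "\<exists>u\<in>V2 \<inter> Z2. u \<le> t" if "t \<in> V1 \<inter> Z1" for t
    using down2[of t] cross(1) that by (meson subsetD)
  have below2: "\<exists>u\<in>V1 \<inter> Z1. u \<le> t" if "t \<in> V2 \<inter> Z2" for t
    using down1[of t] cross(2) that by (meson subsetD)
  have ne: "V1 \<inter> Z1 \<noteq> {}" "V2 \<inter> Z2 \<noteq> {}"
    using nonempty down1 down2 below1 below2 by (metis all_not_in_conv)+
  have bdd: "bdd_below (V1 \<inter> Z1)" "bdd_below (V2 \<inter> Z2)"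
    using V by (intro bdd_belowI[of _ 0]; auto)+
  have "Inf (V1 \<inter> Z1) = Inf (V2 \<inter> Z2)"
  proof (rule antisym)
    show "Inf (V1 \<inter> Z1) \<le> Inf (V2 \<inter> Z2)"
      using ne(2) bdd(1) below2 by (rule cInf_mono)
    show "Inf (V2 \<inter> Z2) \<le> Inf (V1 \<inter> Z1)"
      using ne(1) bdd(2) below1 by (rule cInf_mono)
  qed
  moreover have "Inf (V1 \<inter> Z1) \<in> Z1"
    using closure_contains_Inf[OF ne(1) bdd(1)] closure_minimal[OF Int_lower2 closed(1)]
    by (rule subsetD[rotated])
  moreover have "Inf (V2 \<inter> Z2) \<in> Z2"
    using closure_contains_Inf[OF ne(2) bdd(2)] closure_minimal[OF Int_lower2 closed(2)]
    by (rule subsetD[rotated])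
  ultimately show False
    using disj by auto
qed

text \<open>
  One path of a reflected problem, stated in terms of the barriers \<open>\<alpha> < \<beta>\<close> themselves: \<open>U\<close> pushes \<open>Y\<close> up
  from \<open>\<alpha>\<close> and \<open>D\<close> pushes it down from \<open>\<beta>\<close>. The values at time \<open>0\<close> are initial jumps, whence the
  sign conditions there.
\<close>
definition two_barrier_path ::
  "real \<Rightarrow> (real \<Rightarrow> real) \<Rightarrow> (real \<Rightarrow> real) \<Rightarrow> (real \<Rightarrow> real) \<Rightarrow> (real \<Rightarrow> real) \<Rightarrow> (real \<Rightarrow> real) \<Rightarrow> bool"
  where
  "two_barrier_path T \<alpha> \<beta> Y U D \<longleftrightarrow>
     continuous_on {0..T} Y \<and> (\<forall>t\<in>{0..T}. \<alpha> t \<le> Y t \<and> Y t \<le> \<beta> t) \<and>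
     continuous_on {0..T} U \<and> mono_on {0..T} U \<and> 0 \<le> U 0 \<and>
     continuous_on {0..T} D \<and> mono_on {0..T} D \<and> 0 \<le> D 0 \<and>
     (AE s in stieltjes T U. s \<in> {0..T} \<longrightarrow> Y s = \<alpha> s) \<and>
     (AE s in stieltjes T D. s \<in> {0..T} \<longrightarrow> Y s = \<beta> s)"

text \<open>
  The criterion that yields all four bounds: nondecreasing candidates \<open>H\<close> and \<open>J\<close> dominate the two
  pushes as soon as, at the barrier, an excess of one push over its candidate entails an excess of
  the other.
\<close>
lemma two_barrier_domination:
  assumes path: "two_barrier_path T \<alpha> \<beta> Y U D"
    and bar: "continuous_on {0..T} \<alpha>" "continuous_on {0..T} \<beta>" "\<And>t. t \<in> {0..T} \<Longrightarrow> \<alpha> t < \<beta> t"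
    and H: "continuous_on {0..T} H" "mono_on {0..T} H" "0 \<le> H 0"
    and J: "continuous_on {0..T} J" "mono_on {0..T} J" "0 \<le> J 0"
    and lower: "\<And>u. u \<in> {0..T} \<Longrightarrow> Y u = \<alpha> u \<Longrightarrow> H u < U u \<Longrightarrow> J u < D u"
    and upper: "\<And>u. u \<in> {0..T} \<Longrightarrow> Y u = \<beta> u \<Longrightarrow> J u < D u \<Longrightarrow> H u < U u"
    and t: "t \<in> {0..T}"
  shows "U t \<le> H t \<and> D t \<le> J t"
proof -
  have Y: "continuous_on {0..T} Y"
    and U: "continuous_on {0..T} U" "mono_on {0..T} U" "0 \<le> U 0"
    and D: "continuous_on {0..T} D" "mono_on {0..T} D" "0 \<le> D 0"
    and AEU: "AE s in stieltjes T U. s \<in> {0..T} \<longrightarrow> Y s = \<alpha> s"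
    and AED: "AE s in stieltjes T D. s \<in> {0..T} \<longrightarrow> Y s = \<beta> s"
    using path unfolding two_barrier_path_def by blast+
  let ?VU = "{u\<in>{0..T}. H u < U u}" and ?ZU = "{u\<in>{0..T}. Y u = \<alpha> u}"
  let ?VD = "{u\<in>{0..T}. J u < D u}" and ?ZD = "{u\<in>{0..T}. Y u = \<beta> u}"
  have "?VU = {} \<and> ?VD = {}"
  proof (rule alternating_domination)
    show "closed ?ZU" "closed ?ZD"
      using continuous_closed_preimage_constant[OF continuous_on_diff[OF Y bar(1)], of 0]
        continuous_closed_preimage_constant[OF continuous_on_diff[OF Y bar(2)], of 0]
      by simp_all
    show "?ZU \<inter> ?ZD = {}"
      using bar(3) by force
    show "\<exists>u\<le>s. u \<in> ?VU \<inter> ?ZU" if "s \<in> ?VU" for s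
      using overtaking_time[OF U H AEU, of s] that by force
    show "\<exists>u\<le>s. u \<in> ?VD \<inter> ?ZD" if "s \<in> ?VD" for s
      using overtaking_time[OF D J AED, of s] that by force
  qed (use lower upper in auto)
  then show ?thesis
    using t by (auto simp: not_less)
qed

text \<open>
  Each pair of bounds couples one push of the one path with the opposite push: \<open>U'\<close> with \<open>D'\<close>, and
  \<open>U\<close> with \<open>D\<close>. The offsets are chosen so that \<open>c = c\<^sup>+ - c\<^sup>-\<close> turns an excess of the one into an
  excess of the other: at \<open>Y' = \<alpha>\<close> one has \<open>Y' \<le> Y\<close>, and \<open>U' > U + n + c\<^sup>+\<close> then leaves
  \<open>D' - D \<ge> U' - U - n - c > c\<^sup>-\<close>; the other three cases are alike.
\<close>
lemma two_barrier_comparison: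
  assumes path: "two_barrier_path T \<alpha> \<beta> Y U D" and path': "two_barrier_path T \<alpha> \<beta> Y' U' D'"
    and bar: "continuous_on {0..T} \<alpha>" "continuous_on {0..T} \<beta>" "\<And>t. t \<in> {0..T} \<Longrightarrow> \<alpha> t < \<beta> t"
    and n: "continuous_on {0..T} n" "mono_on {0..T} n" "n 0 = 0"
    and diff: "\<And>t. t \<in> {0..T} \<Longrightarrow> Y t - Y' t = c + n t + (U t - U' t) - (D t - D' t)"
    and t: "t \<in> {0..T}"
  shows "U t - neg_part c \<le> U' t" and "U' t \<le> U t + n t + pos_part c"
    and "D' t - neg_part c \<le> D t" and "D t \<le> D' t + n t + pos_part c"
proof -
  have c: "0 \<le> pos_part c" "0 \<le> neg_part c" "c = pos_part c - neg_part c"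
    by (auto simp: pos_part_def neg_part_def max_def)
  have Y: "\<And>t. t \<in> {0..T} \<Longrightarrow> \<alpha> t \<le> Y t \<and> Y t \<le> \<beta> t"
    and UD: "continuous_on {0..T} U" "mono_on {0..T} U" "0 \<le> U 0"
      "continuous_on {0..T} D" "mono_on {0..T} D" "0 \<le> D 0"
    using path unfolding two_barrier_path_def by blast+
  have Y': "\<And>t. t \<in> {0..T} \<Longrightarrow> \<alpha> t \<le> Y' t \<and> Y' t \<le> \<beta> t"
    and UD': "continuous_on {0..T} U'" "mono_on {0..T} U'" "0 \<le> U' 0"
      "continuous_on {0..T} D'" "mono_on {0..T} D'" "0 \<le> D' 0"
    using path' unfolding two_barrier_path_def by blast+
  have mono1: "mono_on {0..T} (\<lambda>s. f s + a)" if "mono_on {0..T} f" for f :: "real \<Rightarrow> real" and a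
    using that by (auto simp: mono_on_def)
  have mono2: "mono_on {0..T} (\<lambda>s. f s + n s + a)" if "mono_on {0..T} f" for f :: "real \<Rightarrow> real" and a
    using that n(2) by (force simp: mono_on_def intro: add_mono)
  have "U' t \<le> U t + n t + pos_part c \<and> D' t \<le> D t + neg_part c"
  proof (rule two_barrier_domination[OF path' bar, of "\<lambda>s. U s + n s + pos_part c"
        "\<lambda>s. D s + neg_part c"])
    fix u assume u: "u \<in> {0..T}"
    show "D u + neg_part c < D' u" if "Y' u = \<alpha> u" "U u + n u + pos_part c < U' u"
      using that diff[OF u] Y[OF u] c by linarith
    show "U u + n u + pos_part c < U' u" if "Y' u = \<beta> u" "D u + neg_part c < D' u"
      using that diff[OF u] Y[OF u] c by linarith
  qed (use UD n c t in \<open>auto intro!: continuous_on_add continuous_on_const mono1 mono2\<close>)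
  moreover have "U t \<le> U' t + neg_part c \<and> D t \<le> D' t + n t + pos_part c"
  proof (rule two_barrier_domination[OF path bar, of "\<lambda>s. U' s + neg_part c"
        "\<lambda>s. D' s + n s + pos_part c"])
    fix u assume u: "u \<in> {0..T}"
    show "D' u + n u + pos_part c < D u" if "Y u = \<alpha> u" "U' u + neg_part c < U u"
      using that diff[OF u] Y'[OF u] c by linarith
    show "U' u + neg_part c < U u" if "Y u = \<beta> u" "D' u + n u + pos_part c < D u"
      using that diff[OF u] Y'[OF u] c by linarith
  qed (use UD' n c t in \<open>auto intro!: continuous_on_add continuous_on_const mono1 mono2\<close>)
  ultimately show "U t - neg_part c \<le> U' t" "U' t \<le> U t + n t + pos_part c"
    "D' t - neg_part c \<le> D t" "D t \<le> D' t + n t + pos_part c"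
    by auto
qed


section \<open>From the reflected problem to its paths\<close>

text \<open>
  The integrands \<open>r(s, X s)\<close> and \<open>-l(s, X s)\<close> are nonnegative, so their vanishing integrals put the
  pushes on the zero sets of the constraints; strict monotonicity in the space variable turns
  these zero sets, and the sign constraints, into statements about the barriers.
\<close>
lemma reflected_solution_qs_path:
  assumes laws: "\<P> \<subseteq> path_laws T" and p: "0 < p"
    and mono: "qs T \<P> (\<lambda>\<omega>. \<forall>t\<in>{0..T}. strict_mono (r t \<omega>) \<and> strict_mono (l t \<omega>))"
    and inv: "qs T \<P> (\<lambda>\<omega>. \<forall>t\<in>{0..T}. r t \<omega> (rinv t \<omega>) = 0 \<and> l t \<omega> (linv t \<omega>) = 0)"
    and sol: "reflected_solution T \<P> p l r S X A Al Ar"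
  shows "qs T \<P> (\<lambda>\<omega>. two_barrier_path T (\<lambda>t. rinv t \<omega>) (\<lambda>t. linv t \<omega>) (\<lambda>t. X t \<omega>)
      (\<lambda>t. Ar t \<omega>) (\<lambda>t. Al t \<omega>) \<and> (\<forall>t\<in>{0..T}. X t \<omega> = S t \<omega> + Ar t \<omega> - Al t \<omega>))"
proof -
  note conj = qs_conj[OF laws]
  have X: "qs T \<P> (\<lambda>\<omega>. continuous_on {0..T} (\<lambda>t. X t \<omega>))"
    using sol p by (intro S_G_qs_continuous[OF laws p]) (auto simp: reflected_solution_def)
  have Al: "qs T \<P> (\<lambda>\<omega>. continuous_on {0..T} (\<lambda>t. Al t \<omega>) \<and> mono_on {0..T} (\<lambda>t. Al t \<omega>))"
    and Ar: "qs T \<P> (\<lambda>\<omega>. continuous_on {0..T} (\<lambda>t. Ar t \<omega>) \<and> mono_on {0..T} (\<lambda>t. Ar t \<omega>))"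
    using sol by (auto simp: reflected_solution_def M_I_def)
  have rest: "qs T \<P> (\<lambda>\<omega>. 0 \<le> Al 0 \<omega> \<and> 0 \<le> Ar 0 \<omega>)"
    "qs T \<P> (\<lambda>\<omega>. \<forall>t\<in>{0..T}. X t \<omega> = S t \<omega> + A t \<omega>)"
    "qs T \<P> (\<lambda>\<omega>. \<forall>t\<in>{0..T}. l t \<omega> (X t \<omega>) \<le> 0 \<and> 0 \<le> r t \<omega> (X t \<omega>))"
    "qs T \<P> (\<lambda>\<omega>. \<forall>t\<in>{0..T}. A t \<omega> = Ar t \<omega> - Al t \<omega>)"
    "qs T \<P> (\<lambda>\<omega>.
       has_bochner_integral (stieltjes T (\<lambda>t. Al t \<omega>))
         (\<lambda>s. indicator {0..T} s * l s \<omega> (X s \<omega>)) 0 \<and>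
       has_bochner_integral (stieltjes T (\<lambda>t. Ar t \<omega>))
         (\<lambda>s. indicator {0..T} s * r s \<omega> (X s \<omega>)) 0)"
    using sol unfolding reflected_solution_def by blast+
  show ?thesis
  proof (rule qs_mono[OF conj[OF conj[OF mono inv] conj[OF X conj[OF Al conj[OF Ar conj[OF rest(1)
          conj[OF rest(2) conj[OF rest(3) conj[OF rest(4,5)]]]]]]]]], elim conjE)
    fix \<omega>
    assume mono: "\<forall>t\<in>{0..T}. strict_mono (r t \<omega>) \<and> strict_mono (l t \<omega>)"
      and inv: "\<forall>t\<in>{0..T}. r t \<omega> (rinv t \<omega>) = 0 \<and> l t \<omega> (linv t \<omega>) = 0"
      and X: "continuous_on {0..T} (\<lambda>t. X t \<omega>)"
      and Al: "continuous_on {0..T} (\<lambda>t. Al t \<omega>)" "mono_on {0..T} (\<lambda>t. Al t \<omega>)"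
      and Ar: "continuous_on {0..T} (\<lambda>t. Ar t \<omega>)" "mono_on {0..T} (\<lambda>t. Ar t \<omega>)"
      and A0: "0 \<le> Al 0 \<omega>" "0 \<le> Ar 0 \<omega>"
      and XS: "\<forall>t\<in>{0..T}. X t \<omega> = S t \<omega> + A t \<omega>"
      and con: "\<forall>t\<in>{0..T}. l t \<omega> (X t \<omega>) \<le> 0 \<and> 0 \<le> r t \<omega> (X t \<omega>)"
      and A: "\<forall>t\<in>{0..T}. A t \<omega> = Ar t \<omega> - Al t \<omega>"
      and intl: "has_bochner_integral (stieltjes T (\<lambda>t. Al t \<omega>))
         (\<lambda>s. indicator {0..T} s * l s \<omega> (X s \<omega>)) 0"
      and intr: "has_bochner_integral (stieltjes T (\<lambda>t. Ar t \<omega>))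
         (\<lambda>s. indicator {0..T} s * r s \<omega> (X s \<omega>)) 0"
    have r: "0 \<le> r t \<omega> x \<longleftrightarrow> rinv t \<omega> \<le> x" "r t \<omega> x = 0 \<longleftrightarrow> x = rinv t \<omega>"
      and l: "l t \<omega> x \<le> 0 \<longleftrightarrow> x \<le> linv t \<omega>" "l t \<omega> x = 0 \<longleftrightarrow> x = linv t \<omega>"
      if "t \<in> {0..T}" for t x
      using mono inv that by (metis strict_mono_less_eq strict_mono_eq)+
    have "AE s in stieltjes T (\<lambda>t. Ar t \<omega>). indicator {0..T} s * r s \<omega> (X s \<omega>) = 0"
      using intr by (rule has_bochner_integral_nonneg_zero_AE) (use con in \<open>auto simp: indicator_def\<close>)
    then have AEr: "AE s in stieltjes T (\<lambda>t. Ar t \<omega>). s \<in> {0..T} \<longrightarrow> X s \<omega> = rinv s \<omega>"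
      by eventually_elim (use r(2) in \<open>auto simp: indicator_def\<close>)
    have "AE s in stieltjes T (\<lambda>t. Al t \<omega>). - (indicator {0..T} s * l s \<omega> (X s \<omega>)) = 0"
      using has_bochner_integral_minus[OF intl]
      by (intro has_bochner_integral_nonneg_zero_AE) (use con in \<open>auto simp: indicator_def\<close>)
    then have AEl: "AE s in stieltjes T (\<lambda>t. Al t \<omega>). s \<in> {0..T} \<longrightarrow> X s \<omega> = linv s \<omega>"
      by eventually_elim (use l(2) in \<open>auto simp: indicator_def\<close>)
    have "\<forall>t\<in>{0..T}. rinv t \<omega> \<le> X t \<omega> \<and> X t \<omega> \<le> linv t \<omega>"
      using con r(1) l(1) by blast
    then show "two_barrier_path T (\<lambda>t. rinv t \<omega>) (\<lambda>t. linv t \<omega>) (\<lambda>t. X t \<omega>)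
      (\<lambda>t. Ar t \<omega>) (\<lambda>t. Al t \<omega>) \<and> (\<forall>t\<in>{0..T}. X t \<omega> = S t \<omega> + Ar t \<omega> - Al t \<omega>)"
      using X Al Ar A0 AEr AEl XS A unfolding two_barrier_path_def by auto
  qed
qed

theorem proposition3p9:
  fixes T p \<sigma>l \<sigma>u c0 c0' t :: real
    and E :: "rvar \<Rightarrow> real" and \<P> :: "path measure set"
    and l r :: "real \<Rightarrow> path \<Rightarrow> real \<Rightarrow> real"
    and S S' \<nu> X A Al Ar X' A' Al' Ar' :: process
  assumes "G_framework T \<sigma>l \<sigma>u E \<P>"
    and "2 \<le> p"
    and "admissible_pair T \<P> p l r"
    and "S \<in> S_G T \<P> p" and "S' \<in> S_G T \<P> p"
    and "qs T \<P> (\<lambda>\<omega>. S 0 \<omega> = S' 0 \<omega>)"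
    and "reflected_solution T \<P> p l r (\<lambda>s \<omega>. c0 + S s \<omega>) X A Al Ar"
    and "reflected_solution T \<P> p l r (\<lambda>s \<omega>. c0' + S' s \<omega>) X' A' Al' Ar'"
    and "\<nu> \<in> S_G T \<P> p"
    and "qs T \<P> (\<lambda>\<omega>. mono_on {0..T} (\<lambda>s. \<nu> s \<omega>))"
    and "qs T \<P> (\<lambda>\<omega>. \<nu> 0 \<omega> = 0)"
    and "qs T \<P> (\<lambda>\<omega>. \<forall>s\<in>{0..T}. S s \<omega> = S' s \<omega> + \<nu> s \<omega>)"
    and "t \<in> {0..T}"
  shows
   "qs T \<P> (\<lambda>\<omega>. Ar t \<omega> - neg_part (c0 - c0') \<le> Ar' t \<omega> \<and>
                      Ar' t \<omega> \<le> Ar t \<omega> + \<nu> t \<omega> + pos_part (c0 - c0')) \<and>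
    qs T \<P> (\<lambda>\<omega>. Al' t \<omega> - neg_part (c0 - c0') \<le> Al t \<omega> \<and>
                      Al t \<omega> \<le> Al' t \<omega> + \<nu> t \<omega> + pos_part (c0 - c0'))"
proof -
  let ?c = "c0 - c0'"
  have laws: "\<P> \<subseteq> path_laws T"
    using assms(1) by (simp add: G_framework_def)
  have p: "0 < p"
    using assms(2) by simp
  have mono: "qs T \<P> (\<lambda>\<omega>. \<forall>t\<in>{0..T}. strict_mono (r t \<omega>) \<and> strict_mono (l t \<omega>))"
    using assms(3) unfolding admissible_pair_def by (elim conjE) (erule qs_mono, blast)
  obtain rinv linv
    where inv: "qs T \<P> (\<lambda>\<omega>. \<forall>t\<in>{0..T}. r t \<omega> (rinv t \<omega>) = 0 \<and> l t \<omega> (linv t \<omega>) = 0)"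
      and S_G: "rinv \<in> S_G T \<P> p" "linv \<in> S_G T \<P> p"
      and gap: "(INF (t, \<omega>) \<in> {0..T} \<times> Omega T. ereal (linv t \<omega> - rinv t \<omega>)) > 0"
    using assms(3) unfolding admissible_pair_def by blast
  have less: "rinv s \<omega> < linv s \<omega>" if "s \<in> {0..T}" "\<omega> \<in> Omega T" for s \<omega>
  proof -
    have "0 < ereal (linv s \<omega> - rinv s \<omega>)"
      using less_INF_D[OF gap, of "(s, \<omega>)"] that by simp
    then show ?thesis
      by simp
  qed
  note path = reflected_solution_qs_path[OF laws p mono inv]
  note cont = S_G_qs_continuous[OF laws p] and conj = qs_conj[OF laws]
  have "qs T \<P> (\<lambda>\<omega>. (Ar t \<omega> - neg_part ?c \<le> Ar' t \<omega> \<and> Ar' t \<omega> \<le> Ar t \<omega> + \<nu> t \<omega> + pos_part ?c) \<and>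
      (Al' t \<omega> - neg_part ?c \<le> Al t \<omega> \<and> Al t \<omega> \<le> Al' t \<omega> + \<nu> t \<omega> + pos_part ?c))"
  proof (rule qs_mono[OF conj[OF path[OF assms(7)] conj[OF path[OF assms(8)] conj[OF cont[OF S_G(1)]
          conj[OF cont[OF S_G(2)] conj[OF cont[OF assms(9)] conj[OF assms(10) conj[OF assms(11,12)]]]]]]]],
        elim conjE)
    fix \<omega>
    assume \<omega>: "\<omega> \<in> Omega T"
      and sol: "two_barrier_path T (\<lambda>t. rinv t \<omega>) (\<lambda>t. linv t \<omega>) (\<lambda>t. X t \<omega>) (\<lambda>t. Ar t \<omega>) (\<lambda>t. Al t \<omega>)"
        "\<forall>t\<in>{0..T}. X t \<omega> = c0 + S t \<omega> + Ar t \<omega> - Al t \<omega>"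
      and sol': "two_barrier_path T (\<lambda>t. rinv t \<omega>) (\<lambda>t. linv t \<omega>) (\<lambda>t. X' t \<omega>) (\<lambda>t. Ar' t \<omega>) (\<lambda>t. Al' t \<omega>)"
        "\<forall>t\<in>{0..T}. X' t \<omega> = c0' + S' t \<omega> + Ar' t \<omega> - Al' t \<omega>"
      and bar: "continuous_on {0..T} (\<lambda>t. rinv t \<omega>)" "continuous_on {0..T} (\<lambda>t. linv t \<omega>)"
      and \<nu>: "continuous_on {0..T} (\<lambda>t. \<nu> t \<omega>)" "mono_on {0..T} (\<lambda>s. \<nu> s \<omega>)" "\<nu> 0 \<omega> = 0"
      and S: "\<forall>s\<in>{0..T}. S s \<omega> = S' s \<omega> + \<nu> s \<omega>"
    have "X s \<omega> - X' s \<omega> = ?c + \<nu> s \<omega> + (Ar s \<omega> - Ar' s \<omega>) - (Al s \<omega> - Al' s \<omega>)" if "s \<in> {0..T}" for s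
      using sol(2) sol'(2) S that by simp
    from two_barrier_comparison[OF sol(1) sol'(1) bar less[OF _ \<omega>] \<nu> this assms(13)]
    show "(Ar t \<omega> - neg_part ?c \<le> Ar' t \<omega> \<and> Ar' t \<omega> \<le> Ar t \<omega> + \<nu> t \<omega> + pos_part ?c) \<and>
      (Al' t \<omega> - neg_part ?c \<le> Al t \<omega> \<and> Al t \<omega> \<le> Al' t \<omega> + \<nu> t \<omega> + pos_part ?c)"
      by blast
  qed
  then show ?thesis
    by (auto elim: qs_mono)
qed

end
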